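(* Let $n\geq1$ and let $\mathbb{A}_n$ be the $(n+1)$-dimensional $(ax+b)$-group, with underlying space $\mathbb{R}^{n+1}=\mathbb{R}^n\times\mathbb{R}$ and right Haar measure the $(n+1)$-dimensional Lebesgue measure $\mathbf{m}^{n+1}$. Let $\mathrm{CZ}$ denote the family $\{\mathcal{Z}_x\}_{x\in\mathbb{A}_n}$ where $\mathcal{Z}_x$ is the family of all Calderón-Zygmund sets in $\mathbb{A}_n$ containing $x$. Then $$\mathscr{H}^{\mathrm{CZ}}_{\mathbf{m}^{n+1}}\leq4^{n+2}e^{24n}.$$
   Context: The group $\mathbb{A}_n$ is $\mathbb{R}^n\times\mathbb{R}$ with operation $(a,t)\cdot(a',t')=(a+e^ta',t+t')$. A Calderón-Zygmund set in $\mathbb{A}_n$ is a subset of the form $Q\times[t-r,t+r)$, with $t\in\mathbb{R}$, $r>0$, where $Q$ is a left-closed right-open cube in $\mathbb{R}^n$ (a product of intervals $[a_i,a_i+L)$) with side length $L$ such that $$e^2e^tr\leq L<e^8e^tr\ \text{ if }r<1,\qquad e^te^{2r}\leq L<e^te^{8r}\ \text{ if }r\geq1.$$ Let $\mathfrak{Q}=\{\mathcal{Q}_x\}_{x\in X}$, where each $\mathcal{Q}_x$ is a nonempty set of subsets of $X$ containing $x$, let $\mathcal{Q}:=\bigcup_x\mathcal{Q}_x$, and let $\mu$ be an outer measure on $X$ with $0<\mu(Q)<\infty$ for every $Q\in\mathcal{Q}$. For a set function $F:\mathcal{Q}\to[0,\infty]$ define $\mathbf{M}^{\mathfrak{Q}}_\mu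 F(x):=\sup_{Q\in\mathcal{Q}_x}\frac{F(Q)}{\mu(Q)}$ and $\|F\|_{\mathcal{Q}}:=\sup\{\sum_{i=1}^kF(Q_i):Q_1,\ldots,Q_k\in\mathcal{Q},\ Q_i\cap Q_j=\emptyset\text{ for }i\neq j\}$. The Hardy-Littlewood maximal constant $\mathscr{H}^{\mathfrak{Q}}_\mu$ is the smallest constant $c$ (the infimum of all finite $c>0$) such that $\mu\{x\in X:\mathbf{M}^{\mathfrak{Q}}_\mu F(x)>r\}\leq c\,r^{-1}\|F\|_{\mathcal{Q}}$ for every $r>0$ and every $F:\mathcal{Q}\to[0,\infty]$; it is $\infty$ if no such finite $c$ exists. A Borel or Lebesgue measure is identified with the outer measure it induces. *)

theory Defs
  imports "HOL-Analysis.Analysis" "HOL-Algebra.Group"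
begin

(* An indexed family (Q_x), x in X, of nonempty sets Q_x of subsets of X containing x is a function
   QQ on X.  A set function F on the union of the Q_x is a total function on sets, whose
   values outside that union are irrelevant.  mu is an outer measure, positive and finite
   on the members of the Q_x. *)

definition family_union :: "'a set \<Rightarrow> ('a \<Rightarrow> 'a set set) \<Rightarrow> 'a set set" where
  "family_union X QQ = (\<Union>x\<in>X. QQ x)"

definition maximal_operator ::
    "('a \<Rightarrow> 'a set set) \<Rightarrow> ('a set \<Rightarrow> ennreal) \<Rightarrow> ('a set \<Rightarrow> ennreal) \<Rightarrow> 'a \<Rightarrow> ennreal" where
  "maximal_operator QQ \<mu> F x = (SUP Q\<in>QQ x. F Q / \<mu> Q)"

(* The empty packing k = 0 contributes the value 0 and does not affect the supremum. *)
definition packing_norm :: "'a set set \<Rightarrow> ('a set \<Rightarrow> ennreal) \<Rightarrow> ennreal" where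
  "packing_norm \<Q> F = Sup {\<Sum>i=1..k. F (Q i) | (k :: nat) Q.
     (\<forall>i\<in>{1..k}. Q i \<in> \<Q>) \<and> (\<forall>i\<in>{1..k}. \<forall>j\<in>{1..k}. i \<noteq> j \<longrightarrow> Q i \<inter> Q j = {})}"

(* The infimum of the empty set in ennreal is infinity.  As c / r > 0, the bound is infinite
   when the packing norm of F is. *)
definition HL_constant ::
    "'a set \<Rightarrow> ('a \<Rightarrow> 'a set set) \<Rightarrow> ('a set \<Rightarrow> ennreal) \<Rightarrow> ennreal" where
  "HL_constant X QQ \<mu> = Inf {ennreal c | c :: real. 0 < c \<and>
     (\<forall>r :: real. 0 < r \<longrightarrow> (\<forall>F. \<mu> {x \<in> X. ennreal r < maximal_operator QQ \<mu> F x}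
        \<le> ennreal (c * inverse r) * packing_norm (family_union X QQ) F))}"

definition axb_group :: "((real ^ 'n) \<times> real) monoid" where
  "axb_group = \<lparr>carrier = UNIV,
     monoid.mult = (\<lambda>(a, t) (a', t'). (a + exp t *\<^sub>R a', t + t')),
     one = (0, 0)\<rparr>"

lemma group_axb_group: "group (axb_group :: ((real ^ 'n) \<times> real) monoid)"
proof (rule groupI)
  fix x :: "(real ^ 'n) \<times> real"
  obtain a t where x: "x = (a, t)" by (cases x)
  show "\<exists>y\<in>carrier axb_group. y \<otimes>\<^bsub>axb_group\<^esub> x = \<one>\<^bsub>axb_group\<^esub>"
    by (rule bexI[of _ "(- (exp (- t) *\<^sub>R a), - t)"]) (auto simp: axb_group_def x)
qed (auto simp: axb_group_def algebra_simps exp_add split: prod.splits)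

lemma lborel_right_invariant:
  fixes g :: "(real ^ 'n) \<times> real"
  shows "distr lborel borel (\<lambda>x. x \<otimes>\<^bsub>axb_group\<^esub> g) = lborel"
proof (rule measure_eqI)
  obtain b s where g: "g = (b, s)" by (cases g)
  define T where "T = (\<lambda>x. x \<otimes>\<^bsub>axb_group\<^esub> g)"
  have T: "T = (\<lambda>x. (fst x + exp (snd x) *\<^sub>R b, snd x + s))"
    by (auto simp: T_def g axb_group_def split: prod.splits)
  have [measurable]: "T \<in> borel_measurable borel"
    unfolding T by (intro borel_measurable_continuous_onI continuous_intros)
  fix A assume "A \<in> sets (distr lborel borel (\<lambda>x. x \<otimes>\<^bsub>axb_group\<^esub> g))"
  then have A: "A \<in> sets borel" by simp
  have B: "T -` A \<in> sets (lborel \<Otimes>\<^sub>M lborel)"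
    using measurable_sets_borel[OF \<open>T \<in> borel_measurable borel\<close> A]
    by (simp only: lborel_prod sets_lborel)
  have slice: "emeasure lborel ((\<lambda>x. (x, t)) -` (T -` A)) =
      emeasure lborel ((\<lambda>x. (x, s + t)) -` A)" for t
  proof -
    have m: "(\<lambda>x. (x, s + t)) -` A \<in> sets (borel :: (real ^ 'n) measure)"
      using A by (intro measurable_sets_borel[OF _ A] borel_measurable_continuous_onI continuous_intros)
    have "emeasure lborel ((\<lambda>x. (x, s + t)) -` A) =
        emeasure (distr lborel borel ((+) (exp t *\<^sub>R b))) ((\<lambda>x. (x, s + t)) -` A)"
      by (simp add: lborel_distr_plus)
    also have "\<dots> = emeasure lborel ((+) (exp t *\<^sub>R b) -` ((\<lambda>x. (x, s + t)) -` A))"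
      using m by (subst emeasure_distr) auto
    also have "(+) (exp t *\<^sub>R b) -` ((\<lambda>x. (x, s + t)) -` A) = (\<lambda>x. (x, t)) -` (T -` A)"
      by (auto simp: T add.commute)
    finally show ?thesis by simp
  qed
  have meas: "(\<lambda>t. emeasure lborel ((\<lambda>x. (x, t)) -` A)) \<in> borel_measurable borel"
    using lborel_pair.measurable_emeasure_Pair2[of A] A by (simp add: lborel_prod)
  have "emeasure (distr lborel borel T) A = emeasure (lborel \<Otimes>\<^sub>M lborel) (T -` A)"
    using A by (subst emeasure_distr) (auto simp: lborel_prod)
  also have "\<dots> = (\<integral>\<^sup>+t. emeasure lborel ((\<lambda>x. (x, t)) -` (T -` A)) \<partial>lborel)"
    by (rule lborel_pair.emeasure_pair_measure_alt2[OF B])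
  also have "\<dots> = (\<integral>\<^sup>+t. emeasure lborel ((\<lambda>x. (x, s + t)) -` A) \<partial>lborel)"
    by (simp add: slice)
  also have "\<dots> = (\<integral>\<^sup>+t. emeasure lborel ((\<lambda>x. (x, t)) -` A) \<partial>distr lborel borel ((+) s))"
    using meas by (subst nn_integral_distr) auto
  also have "\<dots> = (\<integral>\<^sup>+t. emeasure lborel ((\<lambda>x. (x, t)) -` A) \<partial>lborel)"
    by (simp add: lborel_distr_plus)
  also have "\<dots> = emeasure (lborel \<Otimes>\<^sub>M lborel) A"
    using A by (intro lborel_pair.emeasure_pair_measure_alt2[symmetric]) (simp only: lborel_prod sets_lborel)
  finally show "emeasure (distr lborel borel (\<lambda>x. x \<otimes>\<^bsub>axb_group\<^esub> g)) A = emeasure lborel A"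
    by (simp add: T_def lborel_prod)
qed simp

definition half_open_cube :: "real ^ 'n \<Rightarrow> real \<Rightarrow> (real ^ 'n) set" where
  "half_open_cube a L = {x. \<forall>i. x $ i \<in> {a $ i ..< a $ i + L}}"

definition CZ_sets :: "((real ^ 'n) \<times> real) set set" where
  "CZ_sets = {half_open_cube a L \<times> {t - r ..< t + r} | a L t r. 0 < r \<and>
     (r < 1 \<longrightarrow> exp 2 * exp t * r \<le> L \<and> L < exp 8 * exp t * r) \<and>
     (1 \<le> r \<longrightarrow> exp t * exp (2 * r) \<le> L \<and> L < exp t * exp (8 * r))}"

definition CZ :: "(real ^ 'n) \<times> real \<Rightarrow> ((real ^ 'n) \<times> real) set set" where
  "CZ x = {Z \<in> CZ_sets. x \<in> Z}"

lemma CZ_nonempty: "CZ x \<noteq> {}"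
proof -
  obtain a t where x: "x = (a, t)" by (cases x)
  have "half_open_cube a (exp t * exp 2) \<times> {t - 1 ..< t + 1} \<in> CZ_sets"
    unfolding CZ_sets_def
    by (intro CollectI exI[of _ a] exI[of _ "exp t * exp 2"] exI[of _ t] exI[of _ 1]) auto
  moreover have "x \<in> half_open_cube a (exp t * exp 2) \<times> {t - 1 ..< t + 1}"
    by (auto simp: x half_open_cube_def)
  ultimately show ?thesis unfolding CZ_def by blast
qed

lemma emeasure_CZ_sets:
  fixes Z :: "((real ^ 'n) \<times> real) set"
  assumes "Z \<in> CZ_sets"
  shows "Z \<in> sets lborel" "0 < emeasure lborel Z" "emeasure lborel Z < \<infinity>"
proof -
  obtain a :: "real ^ 'n" and L t r where Z: "Z = half_open_cube a L \<times> {t - r ..< t + r}"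
    and r: "0 < r" and small: "r < 1 \<longrightarrow> exp 2 * exp t * r \<le> L"
    and large: "1 \<le> r \<longrightarrow> exp t * exp (2 * r) \<le> L"
    using assms unfolding CZ_sets_def by blast
  have L: "0 < L"
  proof (cases "r < 1")
    case True
    have "0 < exp 2 * exp t * r" using r by simp
    with small True show ?thesis by linarith
  next
    case False
    have "0 < exp t * exp (2 * r)" by simp
    with large False show ?thesis by linarith
  qed
  define b where "b = a + (\<chi> i. L)"
  have "half_open_cube a L = (\<Inter>i. {x. a $ i \<le> x $ i} \<inter> {x. x $ i < a $ i + L})"
    by (auto simp: half_open_cube_def)
  also have "\<dots> \<in> sets borel"
    by (intro sets.finite_INT sets.Int borel_closed borel_open closed_Collect_le open_Collect_less
        continuous_intros) auto
  finally have "half_open_cube a L \<in> sets borel" .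
  then have "Z \<in> sets (lborel \<Otimes>\<^sub>M lborel)" unfolding Z by (intro pair_measureI) auto
  then show meas: "Z \<in> sets lborel" by (simp only: lborel_prod)
  have "box a b \<subseteq> half_open_cube a L"
    unfolding half_open_cube_def b_def by (auto simp: mem_box_cart intro: less_imp_le)
  moreover have box: "box (a, t - r) (b, t + r) = box a b \<times> {t - r <..< t + r}"
    by (subst box_prod) (simp add: box_real)
  ultimately have sub: "box (a, t - r) (b, t + r) \<subseteq> Z"
    unfolding Z by force
  have "box a b \<noteq> {}"
    using L by (simp add: b_def interval_ne_empty_cart)
  then have "box (a, t - r) (b, t + r) \<noteq> {}"
    using r by (simp add: box)
  then have "emeasure lborel (box (a, t - r) (b, t + r)) \<noteq> 0"
    using open_not_negligible[OF open_box, of "(a, t - r)" "(b, t + r)"]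
      null_sets_completionI[OF null_setsI[of lborel "box (a, t - r) (b, t + r)"]]
    by (metis borel_open negligible_iff_null_sets open_box sets_lborel)
  then show "0 < emeasure lborel Z"
    using emeasure_mono[OF sub meas] by (auto simp: zero_less_iff_neq_zero)
  have "half_open_cube a L \<subseteq> cbox a b"
    unfolding half_open_cube_def b_def by (auto simp: mem_box_cart less_imp_le)
  then have "Z \<subseteq> cbox (a, t - r) (b, t + r)"
    unfolding Z cbox_Pair_eq by (force simp: box_real)
  then have "emeasure lborel Z \<le> emeasure lborel (cbox (a, t - r) (b, t + r))"
    by (intro emeasure_mono) auto
  then show "emeasure lborel Z < \<infinity>"
    using emeasure_lborel_cbox_finite le_less_trans by blast
qed

lemma outer_measure_CZ_sets:
  assumes "Z \<in> CZ_sets"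
  shows "0 < outer_measure_of lebesgue Z" "outer_measure_of lebesgue Z < \<infinity>"
  using emeasure_CZ_sets[OF assms] by simp_all

end

theory Submission
  imports Defs
begin

text \<open>
  The set where the maximal function exceeds a level is a union of Calderon-Zygmund sets
  \<open>Q \<times> [t - r, t + r)\<close>. Neither their measure nor \<open>r\<close> is a suitable size for a Vitali selection
  (for given \<open>r \<ge> 1\<close> the side length may vary by the factor \<open>e\<^bsup>6r\<^esup>\<close>), but the side length \<open>L\<close> of
  \<open>Q\<close> is: since \<open>t' > t - r - r'\<close> whenever two such sets meet, \<open>L' \<le> 2L\<close> forces
  \<open>r' \<le> 3e\<^sup>8 r\<close>. So the set with parameters \<open>(L', r')\<close> lies in the dilate of the other one by \<open>5\<close>
  horizontally and by \<open>1 + 6e\<^sup>8\<close> vertically. Side lengths need not be bounded, so the selection is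
  applied to the sets with \<open>L \<le> N\<close>, after which \<open>N\<close> tends to infinity.
\<close>

section \<open>Selection of a disjoint subfamily\<close>

text \<open>Zorn's lemma gives a maximal family. If it missed some sets, adding one whose size
  exceeds half the supremum over the missed sets would enlarge it; \<open>bdd\<close> makes this
  supremum finite.\<close>

lemma Vitali_selection:
  fixes S :: "'i \<Rightarrow> 'a set" and l :: "'i \<Rightarrow> real"
  assumes ne: "\<And>i. i \<in> I \<Longrightarrow> S i \<noteq> {}"
    and pos: "\<And>i. i \<in> I \<Longrightarrow> 0 < l i"
    and bdd: "\<And>i. i \<in> I \<Longrightarrow> l i \<le> B"
  obtains D where "D \<subseteq> I" "disjoint_family_on S D"
    "\<And>i. i \<in> I \<Longrightarrow> \<exists>j\<in>D. S i \<inter> S j \<noteq> {} \<and> l i \<le> 2 * l j"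
proof -
  \<comment> \<open>The condition concerns only the \<open>i\<close> that meet \<open>D\<close>, so
    the empty family satisfies it and unions of chains inherit it.\<close>
  define \<A> where "\<A> = {D. D \<subseteq> I \<and> disjoint_family_on S D \<and>
    (\<forall>i\<in>I. (\<exists>j\<in>D. S i \<inter> S j \<noteq> {}) \<longrightarrow> (\<exists>j\<in>D. S i \<inter> S j \<noteq> {} \<and> l i \<le> 2 * l j))}"
  have "\<exists>M\<in>\<A>. \<forall>X\<in>\<A>. M \<subseteq> X \<longrightarrow> X = M"
  proof (rule subset_Zorn')
    fix C assume C: "subset.chain \<A> C"
    then have CA: "D \<in> \<A>" if "D \<in> C" for D
      using that by (auto simp: subset_chain_def)
    have "disjoint_family_on S (\<Union>C)"
      unfolding disjoint_family_on_def
    proof (intro ballI impI)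
      fix i j assume "i \<in> \<Union>C" "j \<in> \<Union>C" "i \<noteq> j"
      then obtain D1 D2 where D12: "D1 \<in> C" "i \<in> D1" "D2 \<in> C" "j \<in> D2" by blast
      then have "D1 \<subseteq> D2 \<or> D2 \<subseteq> D1" using C by (simp add: subset_chain_def)
      then obtain D where "D \<in> C" "i \<in> D" "j \<in> D" using D12 by blast
      moreover from this CA have "disjoint_family_on S D" unfolding \<A>_def by blast
      ultimately show "S i \<inter> S j = {}" using \<open>i \<noteq> j\<close> by (simp add: disjoint_family_on_def)
    qed
    moreover have "\<exists>k\<in>\<Union>C. S i \<inter> S k \<noteq> {} \<and> l i \<le> 2 * l k"
      if i: "i \<in> I" and j: "j \<in> \<Union>C" "S i \<inter> S j \<noteq> {}" for i j
    proof -
      obtain D where D: "D \<in> C" "j \<in> D" using j by blast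
      with CA[of D] i j(2) have "\<exists>k\<in>D. S i \<inter> S k \<noteq> {} \<and> l i \<le> 2 * l k"
        unfolding \<A>_def by blast
      with D show ?thesis by blast
    qed
    moreover have "\<Union>C \<subseteq> I" using CA unfolding \<A>_def by blast
    ultimately show "\<Union>C \<in> \<A>" unfolding \<A>_def by blast
  qed
  then obtain M where M: "M \<in> \<A>" and max: "\<And>X. X \<in> \<A> \<Longrightarrow> M \<subseteq> X \<Longrightarrow> X = M" by blast
  define J where "J = {i\<in>I. \<forall>j\<in>M. S i \<inter> S j = {}}"
  have "J = {}"
  proof (rule ccontr)
    assume "J \<noteq> {}"
    then obtain i0 where i0: "i0 \<in> J" by blast
    have bdd': "bdd_above (l ` J)" using bdd by (auto simp: J_def intro!: bdd_aboveI2)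
    have "l i0 \<le> Sup (l ` J)" using i0 bdd' by (intro cSup_upper) auto
    moreover have "0 < l i0" using i0 pos by (auto simp: J_def)
    ultimately have "Sup (l ` J) / 2 < Sup (l ` J)" by simp
    then have "\<exists>y\<in>l ` J. Sup (l ` J) / 2 < y"
      using less_cSup_iff[OF _ bdd', of "Sup (l ` J) / 2"] \<open>J \<noteq> {}\<close> by blast
    then obtain k where k: "k \<in> J" "Sup (l ` J) / 2 < l k" by blast
    have half: "l i \<le> 2 * l k" if "i \<in> J" for i
      using cSup_upper[OF imageI[OF that] bdd'] k(2) by simp
    have kI: "k \<in> I" and kM: "\<And>j. j \<in> M \<Longrightarrow> S k \<inter> S j = {}" using k by (auto simp: J_def)
    have "insert k M \<in> \<A>"
      unfolding \<A>_def
    proof (intro CollectI conjI ballI impI)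
      show "insert k M \<subseteq> I" using M kI by (auto simp: \<A>_def)
      show "disjoint_family_on S (insert k M)"
        using M kM unfolding \<A>_def disjoint_family_on_def by blast
    next
      fix i assume i: "i \<in> I" and meet: "\<exists>j\<in>insert k M. S i \<inter> S j \<noteq> {}"
      show "\<exists>j\<in>insert k M. S i \<inter> S j \<noteq> {} \<and> l i \<le> 2 * l j"
      \<comment> \<open>A member of \<open>J\<close> misses all of \<open>M\<close>, so it can only
        meet \<open>S k\<close>, and \<open>half\<close> applies. Any other \<open>i\<close> meets
        \<open>M\<close> and is covered by the condition on \<open>M\<close>.\<close>
      proof (cases "i \<in> J")
        case True
        then show ?thesis using meet half by (auto simp: J_def)
      next
        case False
        then show ?thesis using i M unfolding J_def \<A>_def by blast
      qed
    qed
    then have "k \<in> M" using max by blast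
    with kM have "S k = {}" by blast
    with ne kI show False by blast
  qed
  with M have "\<exists>j\<in>M. S i \<inter> S j \<noteq> {} \<and> l i \<le> 2 * l j" if "i \<in> I" for i
    using that unfolding \<A>_def J_def by blast
  with M that[of M] show ?thesis unfolding \<A>_def by blast
qed

section \<open>Finite packings and countable unions\<close>

text \<open>\<open>packing_norm\<close> only sees finite packings, whereas the selected family may
  be infinite. Continuity from below along finite pieces of an enumeration bridges the gap.\<close>

lemma emeasure_UN_le_if_finite:
  assumes "countable D" and meas: "\<And>i. i \<in> D \<Longrightarrow> A i \<in> sets M"
    and fin: "\<And>E. finite E \<Longrightarrow> E \<subseteq> D \<Longrightarrow> (\<Sum>i\<in>E. emeasure M (A i)) \<le> b"
  shows "emeasure M (\<Union>i\<in>D. A i) \<le> b"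
proof (cases "D = {}")
  case False
  define E where "E n = from_nat_into D ` {..<n}" for n :: nat
  have E: "finite (E n)" "E n \<subseteq> D" for n
    using from_nat_into[OF False] by (auto simp: E_def)
  have "(\<Union>n. E n) = range (from_nat_into D)" by (auto simp: E_def)
  then have D: "(\<Union>n. E n) = D" using range_from_nat_into[OF False \<open>countable D\<close>] by simp
  have "emeasure M (\<Union>i\<in>D. A i) = emeasure M (\<Union>n. \<Union>i\<in>E n. A i)"
    unfolding D[symmetric] by simp
  also have "\<dots> = (SUP n. emeasure M (\<Union>i\<in>E n. A i))"
  proof (rule SUP_emeasure_incseq[symmetric])
    have "(\<Union>i\<in>E n. A i) \<in> sets M" for n
      using E[of n] meas by (intro sets.finite_UN) auto
    then show "range (\<lambda>n. \<Union>i\<in>E n. A i) \<subseteq> sets M" by blast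
    show "incseq (\<lambda>n. \<Union>i\<in>E n. A i)"
      unfolding incseq_def E_def by (intro allI impI UN_mono image_mono) auto
  qed
  also have "\<dots> \<le> b"
  proof (rule SUP_least)
    fix n
    have "emeasure M (\<Union>i\<in>E n. A i) \<le> (\<Sum>i\<in>E n. emeasure M (A i))"
      using E meas by (intro emeasure_subadditive_finite) auto
    also have "\<dots> \<le> b" using E by (rule fin)
    finally show "emeasure M (\<Union>i\<in>E n. A i) \<le> b" .
  qed
  finally show ?thesis .
qed simp

lemma sum_le_packing_norm:
  assumes "finite E" "\<And>i. i \<in> E \<Longrightarrow> S i \<in> \<Q>" "disjoint_family_on S E"
  shows "(\<Sum>i\<in>E. F (S i)) \<le> packing_norm \<Q> F"
proof -
  obtain h where h: "bij_betw h {1..card E} E" using ex_bij_betw_nat_finite_1[OF assms(1)] by blast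
  have "(\<Sum>i\<in>E. F (S i)) = (\<Sum>i=1..card E. F ((S \<circ> h) i))"
    using sum.reindex_bij_betw[OF h, of "\<lambda>i. F (S i)"] by simp
  moreover have "(S \<circ> h) i \<in> \<Q>" if "i \<in> {1..card E}" for i
    using assms(2) bij_betwE[OF h] that by simp
  moreover have "(S \<circ> h) i \<inter> (S \<circ> h) j = {}"
    if "i \<in> {1..card E}" "j \<in> {1..card E}" "i \<noteq> j" for i j
    using assms(3) bij_betwE[OF h] inj_onD[OF bij_betw_imp_inj_on[OF h]] that
    unfolding disjoint_family_on_def by (metis comp_apply)
  ultimately show ?thesis
    unfolding packing_norm_def by (intro Sup_upper CollectI exI[of _ "card E"] exI[of _ "S \<circ> h"]) blast
qed

section \<open>Volumes of cubes and of their products with intervals\<close>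

text \<open>The cube lies between an open and a closed box of equal volume.\<close>

lemma emeasure_half_open_cube:
  fixes a :: "real ^ 'n"
  assumes "0 < L"
  shows "half_open_cube a L \<in> sets borel"
    and "emeasure lborel (half_open_cube a L) = ennreal (L ^ CARD('n))"
proof -
  define b where "b = a + (\<chi> i. L)"
  have "half_open_cube a L = (\<Inter>i. {x. a $ i \<le> x $ i} \<inter> {x. x $ i < a $ i + L})"
    by (auto simp: half_open_cube_def)
  also have "\<dots> \<in> sets borel"
    by (intro sets.finite_INT sets.Int borel_closed borel_open closed_Collect_le open_Collect_less
        continuous_intros) auto
  finally show meas: "half_open_cube a L \<in> sets borel" .
  have ne: "cbox a b \<noteq> {}" using assms by (simp add: b_def interval_ne_empty_cart)
  have c: "emeasure lborel (cbox a b) = ennreal (L ^ CARD('n))"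
    using content_cbox_cart[OF ne] emeasure_eq_ennreal_measure[of lborel "cbox a b"]
      emeasure_lborel_cbox_finite[of a b]
    by (simp add: b_def)
  have "emeasure lborel (box a b) = emeasure lborel (cbox a b)"
    by (simp add: emeasure_lborel_box_eq emeasure_lborel_cbox_eq)
  moreover have "box a b \<subseteq> half_open_cube a L" "half_open_cube a L \<subseteq> cbox a b"
    by (auto simp: half_open_cube_def b_def mem_box_cart less_imp_le)
  ultimately show "emeasure lborel (half_open_cube a L) = ennreal (L ^ CARD('n))"
    using c emeasure_mono[of "box a b" "half_open_cube a L" lborel]
      emeasure_mono[of "half_open_cube a L" "cbox a b" lborel] meas
    by (simp add: antisym)
qed

lemma emeasure_cube_times_interval:
  fixes a :: "real ^ 'n"
  assumes "0 < L" "0 < r"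
  shows "half_open_cube a L \<times> {t - r ..< t + r} \<in> sets lborel"
    and "emeasure lborel (half_open_cube a L \<times> {t - r ..< t + r}) = ennreal (L ^ CARD('n) * (2 * r))"
proof -
  have "half_open_cube a L \<times> {t - r ..< t + r} \<in> sets (lborel \<Otimes>\<^sub>M lborel)"
    using emeasure_half_open_cube(1)[OF assms(1)] by (intro pair_measureI) auto
  then show "half_open_cube a L \<times> {t - r ..< t + r} \<in> sets lborel"
    by (simp only: lborel_prod)
  have "emeasure lborel (half_open_cube a L \<times> {t - r ..< t + r}) =
      emeasure (lborel \<Otimes>\<^sub>M lborel) (half_open_cube a L \<times> {t - r ..< t + r})"
    by (simp only: lborel_prod)
  also have "\<dots> = ennreal (L ^ CARD('n)) * ennreal (2 * r)"
    using assms emeasure_half_open_cube[of L a]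
    by (subst lborel.emeasure_pair_measure_Times) auto
  finally show "emeasure lborel (half_open_cube a L \<times> {t - r ..< t + r}) =
      ennreal (L ^ CARD('n) * (2 * r))"
    using assms by (simp add: ennreal_mult)
qed

section \<open>Comparison of radii\<close>

definition CZ_params :: "real \<Rightarrow> real \<Rightarrow> real \<Rightarrow> bool" where
  "CZ_params L t r \<longleftrightarrow> 0 < r \<and>
     (r < 1 \<longrightarrow> exp 2 * exp t * r \<le> L \<and> L < exp 8 * exp t * r) \<and>
     (1 \<le> r \<longrightarrow> exp t * exp (2 * r) \<le> L \<and> L < exp t * exp (8 * r))"

lemma CZ_params_pos:
  assumes "CZ_params L t r"
  shows "0 < L" "0 < r"
proof -
  show r: "0 < r" using assms by (simp add: CZ_params_def)
  have "0 < exp 2 * exp t * r" "0 < exp t * exp (2 * r)" using r by simp_all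
  then show "0 < L" using assms unfolding CZ_params_def by linarith
qed

text \<open>Logarithms make the constraints linear in \<open>t\<close>, \<open>r\<close>,
  \<open>ln r\<close> and \<open>ln L\<close>, so that two sets can be compared by linear
  arithmetic.\<close>

lemma CZ_params_ln:
  assumes "CZ_params L t r"
  shows "r < 1 \<Longrightarrow> 2 + t + ln r \<le> ln L" "r < 1 \<Longrightarrow> ln L \<le> 8 + t + ln r"
    "1 \<le> r \<Longrightarrow> t + 2 * r \<le> ln L" "1 \<le> r \<Longrightarrow> ln L \<le> t + 8 * r"
proof -
  note pos = CZ_params_pos[OF assms]
  have upper: "L < exp c \<Longrightarrow> ln L \<le> c" and lower: "exp c \<le> L \<Longrightarrow> c \<le> ln L" for c
    using pos ln_less_cancel_iff[of L "exp c"] by (auto simp: ln_ge_iff)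
  have small: "exp c * exp t * r = exp (c + t + ln r)" for c using pos by (simp add: exp_add)
  have large: "exp t * exp c = exp (t + c)" for c by (simp add: exp_add)
  show "2 + t + ln r \<le> ln L" if "r < 1"
    by (rule lower) (use assms that in \<open>simp add: CZ_params_def flip: small\<close>)
  show "ln L \<le> 8 + t + ln r" if "r < 1"
    by (rule upper) (use assms that in \<open>simp add: CZ_params_def flip: small\<close>)
  show "t + 2 * r \<le> ln L" if "1 \<le> r"
    by (rule lower) (use assms that in \<open>simp add: CZ_params_def flip: large\<close>)
  show "ln L \<le> t + 8 * r" if "1 \<le> r"
    by (rule upper) (use assms that in \<open>simp add: CZ_params_def flip: large\<close>)
qed

text \<open>Insert the lower bound for \<open>ln L'\<close> and the upper bound for
  \<open>ln L\<close> into \<open>ln L' \<le> ln 2 + ln L\<close>, then bound \<open>t - t'\<close>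
  by \<open>r + r'\<close>. The constant \<open>3 * exp 8\<close> serves all four combinations of
  small and large radii.\<close>

lemma CZ_params_radius_le:
  assumes P: "CZ_params L t r" and P': "CZ_params L' t' r'"
    and L: "L' \<le> 2 * L" and meet: "\<bar>t - t'\<bar> < r + r'"
  shows "r' \<le> 3 * exp 8 * r"
proof -
  note pos = CZ_params_pos[OF P] CZ_params_pos[OF P']
  have "ln L' \<le> ln (2 * L)" using L pos by simp
  also have "\<dots> = ln 2 + ln L" using pos by (simp add: ln_mult)
  finally have lnL: "ln L' \<le> ln 2 + ln L" .
  have ln2: "ln 2 \<le> (1::real)" using ln_le_minus_one[of 2] by simp
  have e8: "(9::real) \<le> exp 8" using exp_ge_add_one_self[of 8] by simp
  then have e8r: "9 * r \<le> exp 8 * r" using pos by simp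
  \<comment> \<open>For the case \<open>r < 1 \<le> r'\<close>, which has to bound \<open>r'\<close>
    by a multiple of the possibly tiny \<open>r\<close>: the inequality
    \<open>ln x \<le> x - 1\<close> at \<open>x = 2 * exp 8 * r\<close> absorbs the additive
    constants.\<close>
  have lnr: "8 + ln 2 + ln r \<le> 2 * exp 8 * r - 1"
  proof -
    have "8 + ln 2 + ln r = ln (exp 8 * 2 * r)" using pos by (simp add: ln_mult)
    also have "\<dots> \<le> exp 8 * 2 * r - 1" using pos by (intro ln_le_minus_one) simp
    finally show ?thesis by (simp add: mult_ac)
  qed
  consider "r < 1" "r' < 1" | "r < 1" "1 \<le> r'" | "1 \<le> r" "r' < 1" | "1 \<le> r" "1 \<le> r'" by linarith
  then show ?thesis
  proof cases
    case 1
    \<comment> \<open>Here \<open>t - t' < 2\<close>, which the factor \<open>exp 2\<close> in the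
      lower bound for \<open>L'\<close> compensates.\<close>
    have "ln r' \<le> 8 + ln 2 + ln r"
      using CZ_params_ln(2)[OF P 1(1)] CZ_params_ln(1)[OF P' 1(2)] lnL meet 1 by linarith
    also have "\<dots> = ln (exp 8 * 2 * r)" using pos by (simp add: ln_mult)
    finally have "r' \<le> exp 8 * 2 * r" using pos by (subst (asm) ln_le_cancel_iff) auto
    then show ?thesis using pos e8r by (simp add: mult_ac)
  next
    case 2
    \<comment> \<open>The exponent \<open>2 * r'\<close> in the lower bound for \<open>L'\<close>
      leaves one \<open>r'\<close> after the distance of the centres has used up the other. The same
      happens when both radii are large.\<close>
    have "r' \<le> 8 + ln 2 + ln r + r"
      using CZ_params_ln(2)[OF P 2(1)] CZ_params_ln(3)[OF P' 2(2)] lnL meet by linarith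
    then show ?thesis using lnr e8r pos by linarith
  next
    case 3
    then show ?thesis using e8r by linarith
  next
    case 4
    have "r' \<le> 9 * r + ln 2"
      using CZ_params_ln(4)[OF P 4(1)] CZ_params_ln(3)[OF P' 4(2)] lnL meet by linarith
    then show ?thesis using ln2 e8r 4 by linarith
  qed
qed

section \<open>Boxes, dilates and countability\<close>

fun CZ_box :: "(real ^ 'n) \<times> real \<times> real \<times> real \<Rightarrow> ((real ^ 'n) \<times> real) set" where
  "CZ_box (a, L, t, r) = half_open_cube a L \<times> {t - r ..< t + r}"

text \<open>A cube of side at most \<open>2 * L\<close> that meets the cube at \<open>a\<close>
  stays within \<open>2 * L\<close> of it on either side, whence \<open>5 * L\<close>. An interval
  of half-length \<open>r' \<le> 3 * exp 8 * r\<close> that meets the one about \<open>t\<close>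
  stays within \<open>r + 2 * r'\<close> of \<open>t\<close>.\<close>

fun CZ_dilate :: "(real ^ 'n) \<times> real \<times> real \<times> real \<Rightarrow> ((real ^ 'n) \<times> real) set" where
  "CZ_dilate (a, L, t, r) = half_open_cube (a - (\<chi> i. 2 * L)) (5 * L) \<times>
     {t - (1 + 6 * exp 8) * r ..< t + (1 + 6 * exp 8) * r}"

text \<open>The selection runs over parameters instead of sets, so that the side length can be read
  off directly.\<close>

definition CZ_index :: "((real ^ 'n) \<times> real \<times> real \<times> real) set" where
  "CZ_index = {(a, L, t, r). CZ_params L t r}"

abbreviation side :: "(real ^ 'n) \<times> real \<times> real \<times> real \<Rightarrow> real" where
  "side p \<equiv> fst (snd p)"

lemma CZ_sets_eq: "CZ_sets = CZ_box ` CZ_index"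
  unfolding CZ_sets_def CZ_index_def CZ_params_def image_def by (auto simp: Bex_def)

lemma CZ_box_subset_dilate:
  fixes p q :: "(real ^ 'n) \<times> real \<times> real \<times> real"
  assumes p: "p \<in> CZ_index" and q: "q \<in> CZ_index"
    and meet: "CZ_box q \<inter> CZ_box p \<noteq> {}" and side: "side q \<le> 2 * side p"
  shows "CZ_box q \<subseteq> CZ_dilate p"
proof -
  obtain a L t r where p_eq: "p = (a, L, t, r)" by (cases p)
  obtain a' L' t' r' where q_eq: "q = (a', L', t', r')" by (cases q)
  have P: "CZ_params L t r" "CZ_params L' t' r'"
    using p q by (auto simp: CZ_index_def p_eq q_eq)
  obtain z where "z \<in> CZ_box q" "z \<in> CZ_box p" using meet by blast
  then obtain y u where y: "y \<in> half_open_cube a L" "y \<in> half_open_cube a' L'"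
    and u: "u \<in> {t - r ..< t + r}" "u \<in> {t' - r' ..< t' + r'}"
    unfolding p_eq q_eq CZ_box.simps by blast
  have L': "L' \<le> 2 * L" using side by (simp add: p_eq q_eq)
  \<comment> \<open>The common height \<open>u\<close> forces
    \<open>\<bar>t - t'\<bar> < r + r'\<close>.\<close>
  have r': "r' \<le> 3 * exp 8 * r"
    using u by (intro CZ_params_radius_le[OF P L']) auto
  have "x \<in> half_open_cube (a - (\<chi> i. 2 * L)) (5 * L)" if "x \<in> half_open_cube a' L'" for x
    unfolding half_open_cube_def
  proof (intro CollectI allI)
    fix i
    have "a $ i \<le> y $ i" "y $ i < a $ i + L" "a' $ i \<le> y $ i" "y $ i < a' $ i + L'"
      "a' $ i \<le> x $ i" "x $ i < a' $ i + L'"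
      using y that by (auto simp: half_open_cube_def)
    then show "x $ i \<in> {(a - (\<chi> i. 2 * L)) $ i ..< (a - (\<chi> i. 2 * L)) $ i + 5 * L}"
      using L' by auto
  qed
  moreover have "s \<in> {t - (1 + 6 * exp 8) * r ..< t + (1 + 6 * exp 8) * r}"
    if "s \<in> {t' - r' ..< t' + r'}" for s
    using that u r' by (auto simp: algebra_simps)
  ultimately show ?thesis by (auto simp: p_eq q_eq simp del: atLeastLessThan_iff)
qed

lemma emeasure_CZ_dilate:
  fixes p :: "(real ^ 'n) \<times> real \<times> real \<times> real"
  assumes "p \<in> CZ_index"
  shows "CZ_dilate p \<in> sets lborel"
    and "emeasure lborel (CZ_dilate p) =
      ennreal (5 ^ CARD('n) * (1 + 6 * exp 8)) * emeasure lborel (CZ_box p)"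
proof -
  obtain a L t r where p_eq: "p = (a, L, t, r)" by (cases p)
  have pos: "0 < L" "0 < r" using assms CZ_params_pos by (auto simp: CZ_index_def p_eq)
  have pos': "0 < 5 * L" "0 < (1 + 6 * exp 8) * r"
    using pos exp_gt_zero[of "8 :: real"] by (auto intro!: mult_pos_pos add_pos_pos)
  show "CZ_dilate p \<in> sets lborel"
    unfolding p_eq CZ_dilate.simps by (rule emeasure_cube_times_interval[OF pos'])
  show "emeasure lborel (CZ_dilate p) =
      ennreal (5 ^ CARD('n) * (1 + 6 * exp 8)) * emeasure lborel (CZ_box p)"
    unfolding p_eq CZ_dilate.simps CZ_box.simps
      emeasure_cube_times_interval(2)[OF pos'] emeasure_cube_times_interval(2)[OF pos]
    using pos by (subst ennreal_mult[symmetric]) (auto simp: power_mult_distrib mult_ac intro!: add_nonneg_nonneg)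
qed

lemma interior_CZ_box_nonempty:
  assumes "p \<in> CZ_index"
  shows "interior (CZ_box p) \<noteq> {}"
proof -
  obtain a L t r where p_eq: "p = (a, L, t, r)" by (cases p)
  have pos: "0 < L" "0 < r" using assms CZ_params_pos by (auto simp: CZ_index_def p_eq)
  have "box a (a + (\<chi> i. L)) \<times> {t - r <..< t + r} \<subseteq> CZ_box p"
    by (auto simp: p_eq half_open_cube_def mem_box_cart intro: less_imp_le)
  then have "box a (a + (\<chi> i. L)) \<times> {t - r <..< t + r} \<subseteq> interior (CZ_box p)"
    by (intro interior_maximal open_Times) (auto simp: open_box)
  moreover have "box a (a + (\<chi> i. L)) \<noteq> {}" using pos by (simp add: interval_ne_empty_cart)
  moreover have "{t - r <..< t + r} \<noteq> {}" using pos by simp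
  ultimately show ?thesis by blast
qed

lemma CZ_box_nonempty: "p \<in> CZ_index \<Longrightarrow> CZ_box p \<noteq> {}"
  using interior_CZ_box_nonempty[of p] by (metis interior_empty)

text \<open>Disjoint sets with nonempty interior in a Euclidean space are countable in number. Since
  boxes are nonempty, disjointness makes \<open>CZ_box\<close> injective on \<open>D\<close>, and
  countability passes to the parameters.\<close>

lemma countable_disjoint_CZ_index:
  assumes "D \<subseteq> CZ_index" "disjoint_family_on CZ_box D"
  shows "countable D"
proof -
  have ne: "CZ_box p \<noteq> {}" if "p \<in> D" for p
    using CZ_box_nonempty assms(1) that by blast
  have "countable (CZ_box ` D)"
  proof (rule countable_disjoint_nonempty_interior_subsets)
    show "pairwise disjnt (CZ_box ` D)"
      using assms(2) by (intro pairwise_imageI) (auto simp: disjnt_def dest: disjoint_family_onD simp del: CZ_box.simps)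
    show "S = {}" if "S \<in> CZ_box ` D" "interior S = {}" for S
    proof -
      from that(1) obtain p where "p \<in> D" "S = CZ_box p" by (rule imageE)
      then show ?thesis using that(2) interior_CZ_box_nonempty[of p] assms(1) by blast
    qed
  qed
  moreover have "inj_on CZ_box D"
  proof (rule inj_onI, rule ccontr)
    fix p q assume "p \<in> D" "q \<in> D" "CZ_box p = CZ_box q" "p \<noteq> q"
    with assms(2) have "CZ_box p = {}" unfolding disjoint_family_on_def by (metis Int_absorb)
    with ne \<open>p \<in> D\<close> show False by blast
  qed
  ultimately show ?thesis using countable_image_inj_on by blast
qed

section \<open>The weak type estimate\<close>

text \<open>The dilates of a disjoint selection cover the union. Each has \<open>K\<close> times the
  measure of its box, hence at most \<open>K / \<rho>\<close> times the value of \<open>F\<close>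
  there, and finite sums of these values are bounded by the packing norm. The bound does not involve
  \<open>B\<close>.\<close>

lemma outer_measure_UN_CZ_box_le:
  fixes I :: "((real ^ 'n) \<times> real \<times> real \<times> real) set"
  assumes I: "I \<subseteq> CZ_index" and bdd: "\<And>p. p \<in> I \<Longrightarrow> side p \<le> B"
    and "0 < \<rho>" and F: "\<And>p. p \<in> I \<Longrightarrow> ennreal \<rho> * emeasure lborel (CZ_box p) \<le> F (CZ_box p)"
  shows "outer_measure_of lebesgue (\<Union>p\<in>I. CZ_box p)
    \<le> ennreal (5 ^ CARD('n) * (1 + 6 * exp 8) * inverse \<rho>) * packing_norm CZ_sets F"
proof -
  define K :: real where "K = 5 ^ CARD('n) * (1 + 6 * exp 8)"
  have K_inv: "K * inverse \<rho> * \<rho> = K" using \<open>0 < \<rho>\<close> by simp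
  have "0 \<le> K" unfolding K_def by (intro mult_nonneg_nonneg add_nonneg_nonneg) auto
  have ne: "CZ_box p \<noteq> {}" if "p \<in> I" for p
    using CZ_box_nonempty I that by blast
  have pos: "0 < side p" if "p \<in> I" for p
    using I that CZ_params_pos(1) by (fastforce simp: CZ_index_def)
  obtain D where D: "D \<subseteq> I" "disjoint_family_on CZ_box D"
    and cover: "\<And>q. q \<in> I \<Longrightarrow> \<exists>p\<in>D. CZ_box q \<inter> CZ_box p \<noteq> {} \<and> side q \<le> 2 * side p"
    using Vitali_selection[of I CZ_box side B] ne pos bdd by metis
  have D': "p \<in> CZ_index" if "p \<in> D" for p using D(1) I that by blast
  have cnt: "countable D" using countable_disjoint_CZ_index D I by blast
  have le: "emeasure lborel (\<Union>p\<in>D. CZ_dilate p) \<le> ennreal (K * inverse \<rho>) * packing_norm CZ_sets F"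
  proof (rule emeasure_UN_le_if_finite[OF cnt])
    fix E assume E: "finite E" "E \<subseteq> D"
    have *: "emeasure lborel (CZ_dilate p) \<le> ennreal (K * inverse \<rho>) * F (CZ_box p)" if "p \<in> E" for p
    proof -
      \<comment> \<open>The factor \<open>\<rho>\<close> is split off from \<open>K\<close> so that
        the hypothesis on \<open>F\<close> applies.\<close>
      have "emeasure lborel (CZ_dilate p) = ennreal (K * inverse \<rho>) * (ennreal \<rho> * emeasure lborel (CZ_box p))"
        using emeasure_CZ_dilate(2)[of p] D'[of p] E(2) that \<open>0 < \<rho>\<close> \<open>0 \<le> K\<close>
        by (subst mult.assoc[symmetric], subst ennreal_mult[symmetric]) (auto simp: K_inv simp flip: K_def)
      also have "\<dots> \<le> ennreal (K * inverse \<rho>) * F (CZ_box p)"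
        using F[of p] D E(2) that by (intro mult_left_mono) auto
      finally show ?thesis .
    qed
    have "(\<Sum>p\<in>E. emeasure lborel (CZ_dilate p)) \<le> (\<Sum>p\<in>E. ennreal (K * inverse \<rho>) * F (CZ_box p))"
      by (rule sum_mono[OF *])
    also have "\<dots> = ennreal (K * inverse \<rho>) * (\<Sum>p\<in>E. F (CZ_box p))"
      by (simp add: sum_distrib_left)
    also have "\<dots> \<le> ennreal (K * inverse \<rho>) * packing_norm CZ_sets F"
    proof (intro mult_left_mono sum_le_packing_norm E(1))
      show "CZ_box p \<in> CZ_sets" if "p \<in> E" for p using D' E(2) that unfolding CZ_sets_eq by blast
      show "disjoint_family_on CZ_box E" by (rule disjoint_family_on_mono[OF E(2) D(2)])
    qed auto
    finally show "(\<Sum>p\<in>E. emeasure lborel (CZ_dilate p))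
      \<le> ennreal (K * inverse \<rho>) * packing_norm CZ_sets F" .
  qed (use emeasure_CZ_dilate(1) D' in blast)
  \<comment> \<open>The union over \<open>I\<close> may be uncountable, but the covering union is
    countable, so there the outer measure agrees with \<open>lborel\<close>.\<close>
  have meas: "(\<Union>p\<in>D. CZ_dilate p) \<in> sets lborel"
    using emeasure_CZ_dilate(1)[OF D'] by (intro sets.countable_UN' cnt) blast
  have "(\<Union>p\<in>I. CZ_box p) \<subseteq> (\<Union>p\<in>D. CZ_dilate p)"
  proof (rule UN_least)
    fix q assume "q \<in> I"
    with cover obtain p where "p \<in> D" "CZ_box q \<inter> CZ_box p \<noteq> {}" "side q \<le> 2 * side p" by blast
    then have "CZ_box q \<subseteq> CZ_dilate p" using D' I \<open>q \<in> I\<close> by (intro CZ_box_subset_dilate) auto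
    with \<open>p \<in> D\<close> show "CZ_box q \<subseteq> (\<Union>p\<in>D. CZ_dilate p)" by blast
  qed
  then have "outer_measure_of lebesgue (\<Union>p\<in>I. CZ_box p) \<le> outer_measure_of lebesgue (\<Union>p\<in>D. CZ_dilate p)"
    by (rule outer_measure_of_mono)
  also have "\<dots> = emeasure lborel (\<Union>p\<in>D. CZ_dilate p)" using meas by simp
  finally show ?thesis using le by (simp add: K_def)
qed

lemma CZ_weak_type:
  fixes F :: "((real ^ 'n) \<times> real) set \<Rightarrow> ennreal"
  assumes "0 < \<rho>"
  shows "outer_measure_of lebesgue {x. ennreal \<rho> < maximal_operator CZ (outer_measure_of lebesgue) F x}
    \<le> ennreal (5 ^ CARD('n) * (1 + 6 * exp 8) * inverse \<rho>) * packing_norm CZ_sets F"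
    (is "outer_measure_of _ ?E \<le> ?b")
proof -
  define I where "I = {p \<in> CZ_index. ennreal \<rho> * emeasure lborel (CZ_box p) \<le> F (CZ_box p)}"
  define U where "U N = (\<Union>p\<in>{p\<in>I. side p \<le> real N}. CZ_box p)" for N
  have "?E \<subseteq> (\<Union>p\<in>I. CZ_box p)"
  proof
    fix x assume "x \<in> ?E"
    then obtain Z where Z: "Z \<in> CZ x" and big: "ennreal \<rho> < F Z / outer_measure_of lebesgue Z"
      by (auto simp: maximal_operator_def less_SUP_iff)
    then obtain p where p: "p \<in> CZ_index" "Z = CZ_box p" "x \<in> Z" by (auto simp: CZ_def CZ_sets_eq)
    then have ZC: "Z \<in> CZ_sets" by (auto simp: CZ_sets_eq)
    \<comment> \<open>Otherwise dividing the reverse inequality by the positive measure of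
      \<open>Z\<close> would contradict \<open>big\<close>.\<close>
    have "outer_measure_of lebesgue Z * ennreal \<rho> \<le> F Z"
      using divide_le_posI_ennreal[OF outer_measure_CZ_sets(1)[OF ZC], of "F Z" "ennreal \<rho>"] big
      by (meson linear not_le)
    then have "p \<in> I"
      using p emeasure_CZ_sets(1)[OF ZC] by (simp add: I_def mult.commute)
    with p show "x \<in> (\<Union>p\<in>I. CZ_box p)" by blast
  qed
  also have "\<dots> \<subseteq> (\<Union>N. U N)"
  proof (rule UN_least)
    fix p assume "p \<in> I"
    moreover obtain N where "side p \<le> real N" using real_arch_simple by blast
    ultimately have "CZ_box p \<subseteq> U N" unfolding U_def by blast
    then show "CZ_box p \<subseteq> (\<Union>N. U N)" by blast
  qed
  finally have "outer_measure_of lebesgue ?E \<le> outer_measure_of lebesgue (\<Union>N. U N)"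
    by (rule outer_measure_of_mono)
  \<comment> \<open>The outer measure induced by a measure is continuous from below along any
    increasing sequence of sets, so measurability of \<open>U N\<close> need not be checked.\<close>
  also have "\<dots> = (SUP N. outer_measure_of lebesgue (U N))"
  proof (rule SUP_outer_measure_of_incseq[symmetric])
    show "incseq U"
      unfolding incseq_def U_def by (intro allI impI UN_mono) (auto intro: order_trans)
  qed simp
  also have "\<dots> \<le> ?b"
  proof (rule SUP_least)
    fix N
    show "outer_measure_of lebesgue (U N) \<le> ?b"
      unfolding U_def
      by (rule outer_measure_UN_CZ_box_le[where B = "real N"]) (use assms in \<open>auto simp: I_def\<close>)
  qed
  finally show ?thesis .
qed

section \<open>The numerical constant\<close>

lemma family_union_CZ: "family_union UNIV CZ = CZ_sets"
proof -
  have "Z \<noteq> {}" if "Z \<in> CZ_sets" for Z :: "((real ^ 'n) \<times> real) set"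
    using emeasure_CZ_sets(2)[OF that] by auto
  then show ?thesis unfolding family_union_def CZ_def by blast
qed

text \<open>The exponent \<open>24 * n\<close> is split as \<open>16 * n + 8 * n\<close>: each
  factor 5 is at most \<open>4 * exp 16\<close>, and \<open>1 + 6 * exp 8\<close> is at most
  \<open>4^2 * exp 8\<close>, where \<open>exp 8 \<le> exp (8 * n)\<close> because
  \<open>1 \<le> n\<close>.\<close>

lemma dilation_constant_le:
  assumes "1 \<le> n"
  shows "5 ^ n * (1 + 6 * exp 8) \<le> 4 ^ (n + 2) * exp (24 * real n)"
proof -
  have e16: "(17::real) \<le> exp 16" using exp_ge_add_one_self[of 16] by simp
  have "(5::real) ^ n \<le> (4 * exp 16) ^ n" by (rule power_mono) (use e16 in auto)
  also have "\<dots> = 4 ^ n * exp (16 * real n)"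
    by (simp add: power_mult_distrib exp_of_nat_mult[symmetric] mult.commute)
  finally have 5: "(5::real) ^ n \<le> 4 ^ n * exp (16 * real n)" .
  have "1 + 6 * exp 8 \<le> 16 * exp (8::real)" using exp_ge_add_one_self[of "8::real"] by simp
  also have "\<dots> \<le> 16 * exp (8 * real n)" using assms by simp
  finally have "5 ^ n * (1 + 6 * exp 8) \<le> 4 ^ n * exp (16 * real n) * (16 * exp (8 * real n))"
    using 5 by (intro mult_mono) (auto intro!: add_nonneg_nonneg)
  also have "\<dots> = 4 ^ (n + 2) * (exp (16 * real n) * exp (8 * real n))"
    by (simp add: power_add)
  also have "\<dots> = 4 ^ (n + 2) * exp (24 * real n)"
    by (simp add: exp_add[symmetric])
  finally show ?thesis .
qed

theorem theorem16:
  shows "HL_constant (carrier (axb_group :: ((real ^ 'n) \<times> real) monoid)) CZ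
           (outer_measure_of lebesgue)
         \<le> ennreal (4 ^ (CARD('n) + 2) * exp (24 * real CARD('n)))"
  unfolding HL_constant_def
\<comment> \<open>The claimed bound is itself one of the constants over which the infimum is
  taken.\<close>
proof (intro Inf_lower CollectI exI conjI refl allI impI)
  fix r :: real and F :: "((real ^ 'n) \<times> real) set \<Rightarrow> ennreal"
  assume "0 < r"
  have "5 ^ CARD('n) * (1 + 6 * exp 8) \<le> 4 ^ (CARD('n) + 2) * exp (24 * real CARD('n))"
    by (rule dilation_constant_le) (simp add: Suc_le_eq)
  then have "ennreal (5 ^ CARD('n) * (1 + 6 * exp 8) * inverse r) * packing_norm CZ_sets F
      \<le> ennreal (4 ^ (CARD('n) + 2) * exp (24 * real CARD('n)) * inverse r) * packing_norm CZ_sets F"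
    using \<open>0 < r\<close> by (intro mult_right_mono ennreal_leI) auto
  with CZ_weak_type[OF \<open>0 < r\<close>, of F]
  show "outer_measure_of lebesgue
      {x \<in> carrier axb_group. ennreal r < maximal_operator CZ (outer_measure_of lebesgue) F x}
    \<le> ennreal (4 ^ (CARD('n) + 2) * exp (24 * real CARD('n)) * inverse r) *
        packing_norm (family_union (carrier axb_group) CZ) F"
    by (simp add: axb_group_def family_union_CZ)
qed (rule refl, rule mult_pos_pos, simp_all)

end
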